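(* Consider a GSWF on three alternatives with $n\ge1$ voters satisfying the IIA condition such that the choice functions between the pairs of alternatives are balanced. If the individual preferences are independent and uniformly distributed over the six linear orderings of the alternatives, then the probability of a rational choice is at least $5/8$.
   Context: There are $n$ voters and three alternatives $A,B,C$. Each voter gives a strict linear ordering of the alternatives; a profile is the collection of the $n$ orderings. Voter $i$'s ordering is encoded by $(x_i,y_i,z_i)\in\{0,1\}^3\setminus\{(0,0,0),(1,1,1)\}$, where $x_i=1$ iff voter $i$ prefers $A$ to $B$, $y_i=1$ iff voter $i$ prefers $B$ to $C$, and $z_i=1$ iff voter $i$ prefers $C$ to $A$. A generalized social welfare function (GSWF) assigns to each profile a preference of the society on each of the three pairs of alternatives (not necessarily transitive). It satisfies Independence of Irrelevant Alternatives (IIA) if the society's preference on each pair depends only on the individual preferences on that pair; so it is given by choice functions $f,g,h:\{0,1\}^n\to\{0,1\}$: society prefers $A$ to $B$ iff $f(x)=1$, $B$ to $C$ iff $g(y)=1$, and $C$ to $A$ iff $h(z)=1$. The choice of the society is irrational for a profile if $f(x)=g(y)=h(z)=1$ or $f(x)=g(y)=h(z)=0$ (no linear ordering results), and rational otherwise. The choice functions are balanced if $\mathbb{E}[f]=\mathbb{E}[g]=\mathbb{E}[h]=1/2$ with respect to the uniform measure on $\{0,1\}^n$. *)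

theory Defs
  imports "HOL-Probability.Probability"
begin

datatype alternative = Alt_A | Alt_B | Alt_C

text \<open>
  A preference is a relation on the alternatives, \<^term>\<open>(a, b) \<in> R\<close> meaning that
  \<open>a\<close> is preferred to \<open>b\<close>.  Voters are the elements of a finite type \<open>'v\<close>, so
  the number of voters is \<open>CARD('v)\<close>, which is at least one.
\<close>

type_synonym preference = "alternative rel"

definition orderings :: "preference set" where
  "orderings = {R. strict_linear_order R}"

definition profiles :: "('v \<Rightarrow> preference) set" where
  "profiles = {p. \<forall>i. p i \<in> orderings}"

text \<open>
  The preference of the society decides each of the three pairs but need not be
  transitive.  The value of a GSWF outside \<open>profiles\<close> is unconstrained and plays no role.
\<close>

definition gswf :: "(('v \<Rightarrow> preference) \<Rightarrow> preference) \<Rightarrow> bool" where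
  "gswf F \<longleftrightarrow> (\<forall>p\<in>profiles. asym (F p) \<and> total (F p))"

definition IIA :: "(('v \<Rightarrow> preference) \<Rightarrow> preference) \<Rightarrow> bool" where
  "IIA F \<longleftrightarrow> (\<forall>a b. a \<noteq> b \<longrightarrow> (\<forall>p\<in>profiles. \<forall>q\<in>profiles.
     (\<forall>i. (a, b) \<in> p i \<longleftrightarrow> (a, b) \<in> q i) \<longrightarrow> ((a, b) \<in> F p \<longleftrightarrow> (a, b) \<in> F q)))"

text \<open>
  The choice function of the pair \<open>a, b\<close>: society's decision when \<open>x i\<close> says whether voter
  \<open>i\<close> prefers \<open>a\<close> to \<open>b\<close>.  It is the function through which an IIA rule factors; see
  \<open>choice_fun_eq\<close> and \<open>ex_profile\<close> below.  The values 1 and 0 are rendered as booleans.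
\<close>

definition choice_fun ::
  "(('v \<Rightarrow> preference) \<Rightarrow> preference) \<Rightarrow> alternative \<Rightarrow> alternative \<Rightarrow> ('v \<Rightarrow> bool) \<Rightarrow> bool" where
  "choice_fun F a b x \<longleftrightarrow>
     (\<exists>p\<in>profiles. (\<forall>i. (a, b) \<in> p i \<longleftrightarrow> x i) \<and> (a, b) \<in> F p)"

definition balanced :: "(('v::finite \<Rightarrow> bool) \<Rightarrow> bool) \<Rightarrow> bool" where
  "balanced f \<longleftrightarrow>
     measure_pmf.expectation (pmf_of_set UNIV) (\<lambda>x. of_bool (f x) :: real) = 1 / 2"

definition irrational :: "preference \<Rightarrow> bool" where
  "irrational R \<longleftrightarrow>
     ((Alt_A, Alt_B) \<in> R \<and> (Alt_B, Alt_C) \<in> R \<and> (Alt_C, Alt_A) \<in> R) \<or>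
     ((Alt_A, Alt_B) \<notin> R \<and> (Alt_B, Alt_C) \<notin> R \<and> (Alt_C, Alt_A) \<notin> R)"

text \<open>
  The voters' orderings are independent, each uniform on the six orderings.  The default
  value \<open>{}\<close> of \<open>Pi_pmf\<close> is never used, as the index set is \<open>UNIV\<close>.
\<close>

definition random_profile :: "('v::finite \<Rightarrow> preference) pmf" where
  "random_profile = Pi_pmf UNIV {} (\<lambda>_. pmf_of_set orderings)"


lemma UNIV_alternative: "UNIV = {Alt_A, Alt_B, Alt_C}"
  using alternative.exhaust by blast

instance alternative :: finite
  by standard (simp add: UNIV_alternative)

definition ordering_of :: "alternative \<Rightarrow> alternative \<Rightarrow> alternative \<Rightarrow> preference" where
  "ordering_of a b c = {(a, b), (b, c), (a, c)}"

lemma all_alternative: "(\<forall>a. P a) \<longleftrightarrow> P Alt_A \<and> P Alt_B \<and> P Alt_C"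
  by (metis alternative.exhaust)

lemma orderings_iff:
  "R \<in> orderings \<longleftrightarrow>
    (\<forall>a b c. (a, b) \<in> R \<longrightarrow> (b, c) \<in> R \<longrightarrow> (a, c) \<in> R) \<and> (\<forall>a. (a, a) \<notin> R) \<and>
    (\<forall>a b. a \<noteq> b \<longrightarrow> (a, b) \<in> R \<or> (b, a) \<in> R)"
  by (simp add: orderings_def strict_linear_order_on_def trans_def irrefl_def total_on_def)

lemma orderings_eq:
  "orderings = {ordering_of Alt_A Alt_B Alt_C, ordering_of Alt_A Alt_C Alt_B,
                ordering_of Alt_B Alt_A Alt_C, ordering_of Alt_B Alt_C Alt_A,
                ordering_of Alt_C Alt_A Alt_B, ordering_of Alt_C Alt_B Alt_A}" (is "_ = ?S")
proof (rule set_eqI)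
  fix R :: preference
  show "R \<in> orderings \<longleftrightarrow> R \<in> ?S"
    unfolding orderings_iff set_eq_iff insert_iff empty_iff ordering_of_def split_paired_All all_alternative
    by simp argo
qed

lemma card_orderings: "card orderings = 6"
  by (simp add: orderings_eq ordering_of_def doubleton_eq_iff insert_eq_iff set_eq_iff
      all_alternative)

lemma finite_orderings: "finite orderings"
  by simp

lemma orderings_nonempty: "orderings \<noteq> {}"
  by (simp add: orderings_eq)

lemma choice_fun_eq:
  assumes "IIA F" "p \<in> profiles" "a \<noteq> b"
  shows "choice_fun F a b (\<lambda>i. (a, b) \<in> p i) \<longleftrightarrow> (a, b) \<in> F p"
  using assms unfolding choice_fun_def IIA_def by blast

lemma ex_profile:
  assumes "a \<noteq> b"
  shows "\<exists>p\<in>profiles. \<forall>i. (a, b) \<in> p i \<longleftrightarrow> x i"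
proof -
  have "\<exists>R\<in>orderings. (a, b) \<in> R \<longleftrightarrow> t" for t
    using assms by (cases a; cases b; cases t) (auto simp: orderings_eq ordering_of_def)
  then obtain r where "\<And>t. r t \<in> orderings" "\<And>t. (a, b) \<in> r t \<longleftrightarrow> t"
    by metis
  then show ?thesis
    by (intro bexI[of _ "\<lambda>i. r (x i)"]) (auto simp: profiles_def)
qed

lemma rational_iff_ordering:
  assumes "asym R" "total R"
  shows "\<not> irrational R \<longleftrightarrow> R \<in> orderings"
proof -
  have as: "\<forall>a b. (a, b) \<in> R \<longrightarrow> (b, a) \<notin> R" and to: "\<forall>a b. a \<noteq> b \<longrightarrow> (a, b) \<in> R \<or> (b, a) \<in> R"
    using assms by (auto simp: total_on_def dest: asymD)
  show ?thesis
    using as to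
    unfolding irrational_def orderings_iff all_alternative by simp argo
qed

lemma set_random_profile: "set_pmf random_profile = profiles"
  by (auto simp: random_profile_def set_Pi_pmf PiE_dflt_def profiles_def
      set_pmf_of_set[OF orderings_nonempty finite_orderings])

end

theory Submission
  imports Defs
begin

text \<open>
  For \<open>\<plusminus>1\<close>-valued choice functions the indicator of an irrational choice is
  \<open>(1 + fg + gh + hf) / 4\<close>.  Two different pairs of alternatives have correlation \<open>-1/3\<close> in a
  uniform ordering, so the expectation of \<open>fg + gh + hf\<close> is
  \<open>\<Sum>\<^sub>S (-1/3)\<^bsup>|S|\<^esup> (ab + bc + ca)\<close> with \<open>a, b, c\<close> the Fourier--Walsh coefficients at \<open>S\<close>.
  The term \<open>S = {}\<close> vanishes by balance.  As \<open>ab + bc + ca\<close> lies between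
  \<open>-(a\<^sup>2 + b\<^sup>2 + c\<^sup>2) / 2\<close> and \<open>a\<^sup>2 + b\<^sup>2 + c\<^sup>2\<close>, every other term is at most
  \<open>(a\<^sup>2 + b\<^sup>2 + c\<^sup>2) / 6\<close>, with equality possible only on singletons; by Parseval these sum
  to at most \<open>1/2\<close>.
\<close>

section \<open>Walsh functions and Fourier coefficients on the cube\<close>

definition pm :: "bool \<Rightarrow> real" where
  "pm b = (if b then 1 else -1)"

definition walsh :: "'v set \<Rightarrow> ('v::finite \<Rightarrow> bool) \<Rightarrow> real" where
  "walsh S x = (\<Prod>i\<in>S. pm (x i))"

definition fourier :: "(('v::finite \<Rightarrow> bool) \<Rightarrow> real) \<Rightarrow> 'v set \<Rightarrow> real" where
  "fourier f S = (\<Sum>x\<in>UNIV. f x * walsh S x) / 2 ^ CARD('v)"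

lemma pm_mult_self [simp]: "pm b * pm b = 1"
  by (simp add: pm_def)

text \<open>Expanding the product over all voters \<open>i\<close> of
  \<open>pm (x i) * pm (y i) + 1\<close> gives one term per set \<open>S\<close>. A voter where
  \<open>x\<close> and \<open>y\<close> differ contributes the factor 0; if there is none, every
  factor is 2. Orthogonality in this dual form, summed over \<open>S\<close>, yields Fourier
  inversion directly.\<close>

lemma sum_walsh_mult:
  fixes x y :: "'v::finite \<Rightarrow> bool"
  shows "(\<Sum>S\<in>UNIV. walsh S x * walsh S y) = (if x = y then 2 ^ CARD('v) else 0)"
proof -
  have "(\<Sum>S\<in>UNIV. walsh S x * walsh S y) = (\<Sum>S\<in>Pow UNIV. \<Prod>i\<in>S. pm (x i) * pm (y i))"
    by (simp add: walsh_def prod.distrib)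
  also have "\<dots> = (\<Prod>i\<in>UNIV. pm (x i) * pm (y i) + 1)"
    by (subst prod_add) simp_all
  also have "\<dots> = (if x = y then 2 ^ CARD('v) else 0)"
  proof (cases "x = y")
    case False
    then obtain i where "x i \<noteq> y i"
      by auto
    then have "pm (x i) * pm (y i) + 1 = 0"
      by (auto simp: pm_def)
    then show ?thesis
      using False by (auto simp: prod_zero_iff)
  qed simp
  finally show ?thesis .
qed

lemma fourier_expansion:
  fixes f :: "('v::finite \<Rightarrow> bool) \<Rightarrow> real"
  shows "f x = (\<Sum>S\<in>UNIV. fourier f S * walsh S x)"
proof -
  have "(\<Sum>S\<in>UNIV. fourier f S * walsh S x) =
      (\<Sum>S\<in>UNIV. \<Sum>y\<in>UNIV. f y * (walsh S y * walsh S x)) / 2 ^ CARD('v)"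
    by (simp add: fourier_def sum_distrib_right sum_divide_distrib mult.assoc)
  also have "(\<Sum>S\<in>UNIV. \<Sum>y\<in>UNIV. f y * (walsh S y * walsh S x)) =
      (\<Sum>y\<in>UNIV. f y * (\<Sum>S\<in>UNIV. walsh S y * walsh S x))"
    by (subst sum.swap) (simp add: sum_distrib_left)
  also have "\<dots> = f x * 2 ^ CARD('v)"
    by (simp add: sum_walsh_mult if_distrib cong: if_cong)
  finally show ?thesis
    by simp
qed

text \<open>Only one factor of \<open>(f x)\<^sup>2\<close> is expanded; the other one, summed
  against \<open>walsh S\<close>, gives back the coefficient at \<open>S\<close>.\<close>

lemma parseval:
  fixes f :: "('v::finite \<Rightarrow> bool) \<Rightarrow> real"
  shows "(\<Sum>S\<in>UNIV. (fourier f S)\<^sup>2) = (\<Sum>x\<in>UNIV. (f x)\<^sup>2) / 2 ^ CARD('v)"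
proof -
  have "(\<Sum>x\<in>UNIV. (f x)\<^sup>2) = (\<Sum>x\<in>UNIV. f x * (\<Sum>S\<in>UNIV. fourier f S * walsh S x))"
    using fourier_expansion[of f] by (simp add: power2_eq_square)
  also have "\<dots> = (\<Sum>S\<in>UNIV. \<Sum>x\<in>UNIV. fourier f S * (f x * walsh S x))"
    by (subst sum.swap) (simp add: sum_distrib_left mult_ac)
  also have "\<dots> = (\<Sum>S\<in>UNIV. fourier f S * (fourier f S * 2 ^ CARD('v)))"
    by (simp only: sum_distrib_left[symmetric]) (simp add: fourier_def)
  also have "\<dots> = (\<Sum>S\<in>UNIV. (fourier f S)\<^sup>2) * 2 ^ CARD('v)"
    by (simp add: sum_distrib_right power2_eq_square mult.assoc)
  finally show ?thesis
    by simp
qed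

section \<open>Expectations over independent uniform orderings\<close>

lemma pmf_integrable_finite [simp]:
  fixes f :: "'a::finite \<Rightarrow> real"
  shows "integrable (measure_pmf p) f"
  by (rule integrable_measure_pmf_finite) simp

text \<open>This is independence of the voters: the mass of a profile is a product over voters, and
  the finite sum of products is a product of sums.\<close>

lemma expectation_prod_Pi_pmf_finite:
  fixes u :: "'v::finite \<Rightarrow> 'a::finite \<Rightarrow> real"
  shows "measure_pmf.expectation (Pi_pmf UNIV d P) (\<lambda>p. \<Prod>i\<in>UNIV. u i (p i)) =
    (\<Prod>i\<in>UNIV. measure_pmf.expectation (P i) (u i))"
proof -
  have "measure_pmf.expectation (Pi_pmf UNIV d P) (\<lambda>p. \<Prod>i\<in>UNIV. u i (p i)) =
      (\<Sum>p\<in>PiE UNIV (\<lambda>_. UNIV). \<Prod>i\<in>UNIV. u i (p i) * pmf (P i) (p i))"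
    by (subst integral_measure_pmf_real[where A = UNIV]) (simp_all add: pmf_Pi prod.distrib)
  also have "\<dots> = (\<Prod>i\<in>UNIV. \<Sum>R\<in>UNIV. u i R * pmf (P i) R)"
    by (subst prod_sum_PiE) simp_all
  also have "\<dots> = (\<Prod>i\<in>UNIV. measure_pmf.expectation (P i) (u i))"
    by (intro prod.cong refl, subst integral_measure_pmf_real[where A = UNIV]) simp_all
  finally show ?thesis .
qed

lemma expectation_orderings:
  fixes f :: "preference \<Rightarrow> real"
  shows "measure_pmf.expectation (pmf_of_set orderings) f =
    (f (ordering_of Alt_A Alt_B Alt_C) + f (ordering_of Alt_A Alt_C Alt_B) +
     f (ordering_of Alt_B Alt_A Alt_C) + f (ordering_of Alt_B Alt_C Alt_A) +
     f (ordering_of Alt_C Alt_A Alt_B) + f (ordering_of Alt_C Alt_B Alt_A)) / 6"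
proof -
  have "measure_pmf.expectation (pmf_of_set orderings) f = sum f orderings / 6"
    by (simp only: integral_pmf_of_set[OF orderings_nonempty finite_orderings] card_orderings
        of_nat_numeral)
  also have "sum f orderings =
     f (ordering_of Alt_A Alt_B Alt_C) + f (ordering_of Alt_A Alt_C Alt_B) +
     f (ordering_of Alt_B Alt_A Alt_C) + f (ordering_of Alt_B Alt_C Alt_A) +
     f (ordering_of Alt_C Alt_A Alt_B) + f (ordering_of Alt_C Alt_B Alt_A)"
    by (simp add: orderings_eq ordering_of_def set_eq_iff all_alternative)
  finally show ?thesis .
qed

lemma expectation_pm:
  assumes "a \<noteq> b"
  shows "measure_pmf.expectation (pmf_of_set orderings) (\<lambda>R. pm ((a, b) \<in> R)) = 0"
  using assms
  by (cases a; cases b) (simp_all add: expectation_orderings ordering_of_def pm_def)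

text \<open>The two signs agree only when \<open>b\<close> is ranked in the middle, that is, in two
  of the six orderings, so the mean is (2 - 4) / 6.\<close>

lemma expectation_pm_mult:
  assumes "a \<noteq> b" "b \<noteq> c" "c \<noteq> a"
  shows "measure_pmf.expectation (pmf_of_set orderings)
    (\<lambda>R. pm ((a, b) \<in> R) * pm ((b, c) \<in> R)) = - (1 / 3)"
  using assms
  by (cases a; cases b; cases c) (simp_all add: expectation_orderings ordering_of_def pm_def)

text \<open>By independence the expectation factors over voters: a voter in both sets contributes
  -1/3, a voter in exactly one contributes the mean 0 of a single sign, and a voter in neither
  contributes 1.\<close>

lemma expectation_walsh_mult:
  fixes S T :: "'v::finite set"
  assumes "a \<noteq> b" "b \<noteq> c" "c \<noteq> a"
  shows "measure_pmf.expectation random_profile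
      (\<lambda>p. walsh S (\<lambda>i. (a, b) \<in> p i) * walsh T (\<lambda>i. (b, c) \<in> p i)) =
    (if S = T then (- (1 / 3)) ^ card S else 0)"
proof -
  \<comment> \<open>The default factor 1 lets the products over \<open>S\<close> and over
    \<open>T\<close> both range over all voters.\<close>
  define u where "u i R = (if i \<in> S then pm ((a, b) \<in> R) else 1) * (if i \<in> T then pm ((b, c) \<in> R) else 1)"
    for i R
  have "walsh S (\<lambda>i. (a, b) \<in> p i) * walsh T (\<lambda>i. (b, c) \<in> p i) = (\<Prod>i\<in>UNIV. u i (p i))"
    for p :: "'v \<Rightarrow> preference"
    by (simp add: u_def walsh_def prod.distrib prod.If_cases)
  then have "measure_pmf.expectation random_profile
      (\<lambda>p. walsh S (\<lambda>i. (a, b) \<in> p i) * walsh T (\<lambda>i. (b, c) \<in> p i)) =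
      (\<Prod>i\<in>UNIV. measure_pmf.expectation (pmf_of_set orderings) (u i))"
    by (simp add: random_profile_def expectation_prod_Pi_pmf_finite)
  also have "\<dots> =
      (\<Prod>i\<in>UNIV. if i \<in> S \<longleftrightarrow> i \<in> T then (if i \<in> S then - (1 / 3) else 1) else 0)"
    using assms by (intro prod.cong refl) (simp add: u_def[abs_def] expectation_pm expectation_pm_mult)
  also have "\<dots> =
      (if S = T then (- (1 / 3)) ^ card S else (0::real))"
  proof (cases "S = T")
    case False
    then obtain i where "\<not> (i \<in> S \<longleftrightarrow> i \<in> T)"
      by auto
    then show ?thesis
      using False by (auto simp: prod_zero_iff)
  qed (simp add: prod.If_cases)
  finally show ?thesis .
qed

text \<open>After both functions are expanded, only the diagonal terms \<open>S = T\<close> of the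
  double sum survive.\<close>

lemma expectation_mult:
  fixes f g :: "('v::finite \<Rightarrow> bool) \<Rightarrow> real"
  assumes "a \<noteq> b" "b \<noteq> c" "c \<noteq> a"
  shows "measure_pmf.expectation random_profile
      (\<lambda>p. f (\<lambda>i. (a, b) \<in> p i) * g (\<lambda>i. (b, c) \<in> p i)) =
    (\<Sum>S\<in>UNIV. (- (1 / 3)) ^ card S * (fourier f S * fourier g S))"
proof -
  have "f x * g y = (\<Sum>S\<in>UNIV. \<Sum>T\<in>UNIV. fourier f S * fourier g T * (walsh S x * walsh T y))"
    for x y
    by (subst fourier_expansion[of f], subst fourier_expansion[of g])
      (simp add: sum_product mult_ac)
  then show ?thesis
    by (simp add: expectation_walsh_mult[OF assms] if_distrib mult_ac cong: if_cong)
qed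

section \<open>Fourier coefficients of balanced and of sign-valued functions\<close>

lemma fourier_empty_of_balanced:
  fixes f :: "('v::finite \<Rightarrow> bool) \<Rightarrow> bool"
  assumes "balanced f"
  shows "fourier (\<lambda>x. pm (f x)) {} = 0"
proof -
  have "(\<Sum>x\<in>UNIV. of_bool (f x) :: real) = 2 ^ CARD('v) / 2"
    using assms by (simp add: balanced_def integral_pmf_of_set card_fun field_simps)
  \<comment> \<open>The coefficient at \<open>{}\<close> is the mean, here 2 * (1/2) - 1 =
    0.\<close>
  moreover have "pm (f x) = 2 * of_bool (f x) - 1" for x
    by (simp add: pm_def)
  ultimately show ?thesis
    by (simp add: fourier_def walsh_def sum_subtractf sum_distrib_left[symmetric] card_fun)
qed

lemma sum_fourier_pm:
  fixes f :: "('v::finite \<Rightarrow> bool) \<Rightarrow> bool"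
  shows "(\<Sum>S\<in>UNIV. (fourier (\<lambda>x. pm (f x)) S)\<^sup>2) = 1"
proof -
  have "(pm (f x))\<^sup>2 = 1" for x
    by (simp add: power2_eq_square)
  then show ?thesis
    by (simp add: parseval card_fun)
qed

section \<open>The estimate for a single nonempty set of voters\<close>

lemma power_neg_third_bounds:
  assumes "n > 0"
  shows "- (1 / 3) \<le> (- (1 / 3 :: real)) ^ n" and "(- (1 / 3)) ^ n \<le> (1 / 9 :: real)"
proof -
  define w :: real where "w = (1 / 3) ^ n"
  have "w \<le> (1 / 3) ^ 1"
    unfolding w_def using assms by (intro power_decreasing) auto
  \<comment> \<open>A positive even exponent is at least 2; for odd exponents the power is
    negative.\<close>
  moreover have "w \<le> (1 / 3) ^ 2" if "even n"
    unfolding w_def using assms that by (intro power_decreasing) (auto elim!: evenE)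
  moreover have "0 \<le> w"
    by (simp add: w_def)
  moreover have "(- (1 / 3)) ^ n = (if even n then w else - w)"
    by (simp add: w_def)
  ultimately show "- (1 / 3) \<le> (- (1 / 3 :: real)) ^ n" and "(- (1 / 3)) ^ n \<le> (1 / 9 :: real)"
    by (cases "even n"; simp add: power2_eq_square)+
qed

text \<open>The sign of the pairwise sum \<open>r\<close> decides which bound on \<open>t\<close>
  matters. For \<open>r \<ge> 0\<close>, \<open>r \<le> q\<close> gives the stronger bound
  \<open>q / 9\<close>; for \<open>r < 0\<close>, \<open>- r \<le> q / 2\<close> and
  \<open>t \<ge> - (1 / 3)\<close> give exactly \<open>q / 6\<close>.\<close>

lemma mult_pairwise_sum_le:
  fixes a b c t :: real
  assumes "- (1 / 3) \<le> t" "t \<le> 1 / 9"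
  shows "t * (a * b + b * c + c * a) \<le> (a\<^sup>2 + b\<^sup>2 + c\<^sup>2) / 6"
proof -
  define q where "q = a\<^sup>2 + b\<^sup>2 + c\<^sup>2"
  define r where "r = a * b + b * c + c * a"
  have "q + 2 * r = (a + b + c)\<^sup>2"
    by (simp add: q_def r_def power2_eq_square algebra_simps)
  then have lower: "0 \<le> q + 2 * r"
    by simp
  have "2 * (q - r) = (a - b)\<^sup>2 + (b - c)\<^sup>2 + (c - a)\<^sup>2"
    by (simp add: q_def r_def power2_eq_square algebra_simps)
  then have upper: "r \<le> q"
    by (smt (verit) zero_le_power2)
  have "0 \<le> q"
    by (simp add: q_def)
  have "t * r \<le> q / 6"
  proof (cases "0 \<le> r")
    case True
    then have "t * r \<le> 1 / 9 * r"
      using assms by (intro mult_right_mono)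
    then show ?thesis
      using upper \<open>0 \<le> q\<close> by simp
  next
    case False
    then have "t * r \<le> - (1 / 3) * r"
      using assms by (intro mult_right_mono_neg) auto
    then show ?thesis
      using lower by simp
  qed
  then show ?thesis
    by (simp add: q_def r_def)
qed

section \<open>Bounding the probability of an irrational choice\<close>

theorem theorem4p6:
  fixes F :: "('v::finite \<Rightarrow> preference) \<Rightarrow> preference"
  assumes "gswf F"
    and "IIA F"
    and "balanced (choice_fun F Alt_A Alt_B)"
    and "balanced (choice_fun F Alt_B Alt_C)"
    and "balanced (choice_fun F Alt_C Alt_A)"
  shows "measure_pmf.prob random_profile {p. \<not> irrational (F p)} \<ge> 5 / 8"
proof -
  define f where "f x = pm (choice_fun F Alt_A Alt_B x)" for x
  define g where "g x = pm (choice_fun F Alt_B Alt_C x)" for x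
  define h where "h x = pm (choice_fun F Alt_C Alt_A x)" for x
  let ?E = "measure_pmf.expectation (random_profile :: ('v \<Rightarrow> preference) pmf)"
  let ?x = "\<lambda>p i. (Alt_A, Alt_B) \<in> p i"
  let ?y = "\<lambda>p i. (Alt_B, Alt_C) \<in> p i"
  let ?z = "\<lambda>p i. (Alt_C, Alt_A) \<in> p i"
  \<comment> \<open>The products are taken in cyclic order, so that each pairs some
    \<open>(a, b)\<close> with \<open>(b, c)\<close>, as \<open>expectation_mult\<close>
    requires.\<close>
  let ?r = "\<lambda>p. f (?x p) * g (?y p) + g (?y p) * h (?z p) + h (?z p) * f (?x p)"
  let ?s = "\<lambda>S. fourier f S * fourier g S + fourier g S * fourier h S + fourier h S * fourier f S"
  let ?q = "\<lambda>S. (fourier f S)\<^sup>2 + (fourier g S)\<^sup>2 + (fourier h S)\<^sup>2"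
  have "measure_pmf.prob random_profile {p. irrational (F p)} =
      ?E (indicator {p. irrational (F p)})"
    by simp
  also have "\<dots> = ?E (\<lambda>p. (1 + ?r p) / 4)"
  proof (intro integral_cong_AE)
    \<comment> \<open>The identity is needed only on the support \<open>profiles\<close>, where IIA
      identifies the choice functions with the decisions of \<open>F\<close>. Three signs have
      pairwise sum 3 if all agree and -1 otherwise.\<close>
    show "AE p in random_profile. indicator {p. irrational (F p)} p = (1 + ?r p) / 4"
      by (auto simp: AE_measure_pmf_iff set_random_profile f_def g_def h_def pm_def
          irrational_def choice_fun_eq[OF \<open>IIA F\<close>])
  qed simp_all
  also have "\<dots> = (1 + ?E ?r) / 4"
    by simp
  also have "?E ?r = (\<Sum>S\<in>UNIV. (- (1 / 3)) ^ card S * ?s S)"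
    by (simp add: expectation_mult distrib_left sum.distrib)
  also have "\<dots> \<le> (\<Sum>S\<in>UNIV. ?q S / 6)"
  proof (rule sum_mono)
    fix S :: "'v set"
    show "(- (1 / 3)) ^ card S * ?s S \<le> ?q S / 6"
    proof (cases "S = {}")
      \<comment> \<open>Here the weight is 1, outside the range that
        \<open>mult_pairwise_sum_le\<close> allows; balance makes all three coefficients 0.\<close>
      case True
      then show ?thesis
        using assms(3-5) by (simp add: f_def[abs_def] g_def[abs_def] h_def[abs_def] fourier_empty_of_balanced)
    next
      case False
      then have "card S > 0"
        by (simp add: card_gt_0_iff)
      then show ?thesis
        by (intro mult_pairwise_sum_le power_neg_third_bounds)
    qed
  qed
  \<comment> \<open>Each of the three Parseval sums is 1, so the total is 3/6, and (1 + 1/2) / 4 =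
    3/8 bounds the probability of an irrational choice.\<close>
  also have "\<dots> = 1 / 2"
    by (simp add: f_def[abs_def] g_def[abs_def] h_def[abs_def] sum_divide_distrib[symmetric]
        sum.distrib sum_fourier_pm)
  finally have "measure_pmf.prob random_profile {p. irrational (F p)} \<le> 3 / 8"
    by simp
  moreover have "measure_pmf.prob random_profile {p. \<not> irrational (F p)} =
      1 - measure_pmf.prob random_profile {p. irrational (F p)}"
    using measure_pmf.prob_compl[of "{p. irrational (F p)}" random_profile]
    by (simp add: Compl_eq_Diff_UNIV[symmetric] Collect_neg_eq)
  ultimately show ?thesis
    by simp
qed

end
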